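(* Let $X$ be a Polish space and $A\subseteq X$ an analytic set. Then there is a Borel graph $G\subseteq A^2$ on $X$ of diameter $2$ such that $A$ is a connected component of $G$.
   Context: A graph on $X$ is a symmetric irreflexive relation; the diameter of a graph is the maximum distance between any two vertices that are connected by a path.
   Formalization: A is assumed nonempty (a connected component is nonempty), and the diameter is shown to be exactly 2 when A has at least 3 points; when A has one or two points, where diameter 2 is impossible for a graph contained in A², it is shown to be at most 2. *)

theory Defs
  imports "HOL-Analysis.Analysis"
begin

text \<open>
  The type \<^typ>\<open>nat \<Rightarrow> nat\<close> carries the product topology of the discrete topology
  on \<^typ>\<open>nat\<close>, so it is the Baire space. The empty set is not an image of it and has
  to be admitted separately.
\<close>

definition analytic_set :: "'a::topological_space set \<Rightarrow> bool" where
  "analytic_set A \<longleftrightarrow>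
     A = {} \<or> (\<exists>f :: (nat \<Rightarrow> nat) \<Rightarrow> 'a. continuous_on UNIV f \<and> range f = A)"

definition graph_rel :: "('a \<times> 'a) set \<Rightarrow> bool" where
  "graph_rel G \<longleftrightarrow> sym G \<and> irrefl G"

text \<open>
  Since \<open>(x, y) \<in> G ^^ n\<close> says that there is a walk of length \<open>n\<close> from \<open>x\<close> to \<open>y\<close>,
  the following is the distance of two vertices connected by a path, that is, with
  \<open>(x, y) \<in> G\<^sup>*\<close>. It is meaningless for other pairs.
\<close>

definition graph_dist :: "('a \<times> 'a) set \<Rightarrow> 'a \<Rightarrow> 'a \<Rightarrow> nat" where
  "graph_dist G x y = (LEAST n. (x, y) \<in> G ^^ n)"

text \<open>
  The supremum is taken in \<^typ>\<open>enat\<close>, where a finite supremum of a nonempty set is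
  attained; the value is \<open>\<infinity>\<close> if the distances are unbounded.
\<close>

definition graph_diameter :: "('a \<times> 'a) set \<Rightarrow> enat" where
  "graph_diameter G = (SUP (x, y) \<in> G\<^sup>*. enat (graph_dist G x y))"

text \<open>The vertex set is the whole type. For symmetric \<open>G\<close> the relation \<open>G\<^sup>*\<close> is an equivalence.\<close>

definition graph_component :: "('a \<times> 'a) set \<Rightarrow> 'a set \<Rightarrow> bool" where
  "graph_component G C \<longleftrightarrow> C \<in> UNIV // G\<^sup>*"

end

theory Submission
  imports Defs
begin

text \<open>
  If \<open>A\<close> is countable, a star on \<open>A\<close> works. Otherwise \<open>A\<close> contains a Cantor set \<open>P\<close> (perfect set
  theorem), and every point of \<open>P\<close> codes, in a Borel way, a pair of points of the Baire space, hence
  via a continuous surjection onto \<open>A\<close> a pair of points of \<open>A\<close>. Join \<open>p \<in> P\<close> to both points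
  that it codes. The edge relation is Borel because it consists of two graphs of Borel functions on
  \<open>P\<close>. As each pair \<open>(x, y)\<close> has infinitely many codes, \<open>x\<close> and \<open>y\<close> have a common neighbour. The
  graph is not complete because each edge is chosen by one of its ends, which chooses at most two.
\<close>

section \<open>Graphs in which any two vertices have a common neighbour\<close>

lemma graph_dist_le:
  assumes "(x, y) \<in> G ^^ n"
  shows "graph_dist G x y \<le> n"
  unfolding graph_dist_def by (rule Least_le) (rule assms)

text \<open>Walks starting in \<open>A\<close> stay there because
  \<open>G \<subseteq> A \<times> A\<close>. A point outside \<open>A\<close> reaches only itself
  and contributes distance 0 to the diameter.\<close>

lemma graph_component_diameter_le_2I:
  assumes "sym G" "G \<subseteq> A \<times> A" "a \<in> A"
    and two: "\<And>x y. x \<in> A \<Longrightarrow> y \<in> A \<Longrightarrow> x \<noteq> y \<Longrightarrow> (x, y) \<in> G \<or> (\<exists>z. (x, z) \<in> G \<and> (z, y) \<in> G)"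
  shows "graph_component G A" "graph_diameter G \<le> 2"
proof -
  have closed: "y \<in> A" if "(x, y) \<in> G\<^sup>*" "x \<in> A" for x y
    using that by (induction rule: rtrancl_induct) (use assms(2) in auto)
  have conn: "(x, y) \<in> G\<^sup>*" if "x \<in> A" "y \<in> A" for x y
    using two[OF that] by (cases "x = y") (auto intro: rtrancl_into_rtrancl)
  have "G\<^sup>* `` {a} = A"
    using closed conn \<open>a \<in> A\<close> by blast
  then show "graph_component G A"
    unfolding graph_component_def by (metis UNIV_I quotientI)
  have "graph_dist G x y \<le> 2" if "(x, y) \<in> G\<^sup>*" for x y
  proof (cases "x = y")
    case True
    then have "graph_dist G x y \<le> 0"
      by (intro graph_dist_le) simp
    then show ?thesis by simp
  next
    case False
    then have "x \<in> A"
      using that assms(2) by (auto elim: converse_rtranclE)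
    then have "y \<in> A"
      using closed that by blast
    have "(x, y) \<in> G ^^ 1 \<or> (x, y) \<in> G ^^ 2"
      using two[OF \<open>x \<in> A\<close> \<open>y \<in> A\<close> False] by (auto simp: numeral_2_eq_2)
    then show ?thesis
      using graph_dist_le[of x y 1 G] graph_dist_le[of x y 2 G] by auto
  qed
  then show "graph_diameter G \<le> 2"
    unfolding graph_diameter_def by (auto intro!: SUP_least simp: numeral_eq_enat)
qed

lemma graph_diameter_ge_2I:
  assumes "(x, y) \<in> G\<^sup>*" "x \<noteq> y" "(x, y) \<notin> G"
  shows "2 \<le> graph_diameter G"
proof -
  obtain n where "(x, y) \<in> G ^^ n"
    using assms(1) rtrancl_power by blast
  then have "(x, y) \<in> G ^^ graph_dist G x y"
    unfolding graph_dist_def by (rule LeastI)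
  then have "graph_dist G x y \<noteq> 0" "graph_dist G x y \<noteq> 1"
    using assms(2,3) by (metis pair_in_Id_conv relpow.simps(1), metis relpow_1)
  then have "2 \<le> enat (graph_dist G x y)"
    by (simp add: numeral_eq_enat)
  also have "\<dots> \<le> graph_diameter G"
    unfolding graph_diameter_def by (rule SUP_upper2[OF assms(1)]) simp
  finally show ?thesis .
qed

section \<open>A Cantor set inside an uncountable analytic set\<close>

text \<open>A finite word of length \<open>m\<close> is represented by any infinite sequence
  \<open>x\<close> extending it.\<close>

definition cylinder :: "(nat \<Rightarrow> 'a) \<Rightarrow> nat \<Rightarrow> (nat \<Rightarrow> 'a) set" where
  "cylinder x m = {y. \<forall>i<m. y i = x i}"

lemma self_in_cylinder [simp]: "x \<in> cylinder x m"
  by (simp add: cylinder_def)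

lemma cylinder_subset: "y \<in> cylinder x m \<Longrightarrow> m \<le> k \<Longrightarrow> cylinder y k \<subseteq> cylinder x m"
  by (auto simp: cylinder_def)

lemma open_cylinder [simp]:
  fixes x :: "nat \<Rightarrow> 'a::discrete_topology"
  shows "open (cylinder x m)"
proof -
  have "cylinder x m = (\<Inter>i\<in>{..<m}. (\<lambda>y. y i) -` {x i})"
    by (auto simp: cylinder_def)
  then show ?thesis
    by (auto intro!: open_INT open_vimage open_discrete)
qed

text \<open>A basic open set of the product topology restricts only finitely many coordinates;
  \<open>m\<close> bounds them all.\<close>

lemma open_contains_cylinder:
  fixes U :: "(nat \<Rightarrow> 'a::topological_space) set"
  assumes "open U" "x \<in> U"
  obtains m where "cylinder x m \<subseteq> U"
proof -
  have "openin (product_topology (\<lambda>_. euclidean) UNIV) U"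
    using assms(1) by (simp add: open_fun_def)
  from product_topology_open_contains_basis[OF this assms(2)]
  obtain X where X: "x \<in> Pi\<^sub>E UNIV X" "finite {i. X i \<noteq> UNIV}" "Pi\<^sub>E UNIV X \<subseteq> U"
    unfolding topspace_euclidean by blast
  obtain m where m: "\<forall>i\<in>{i. X i \<noteq> UNIV}. i < m"
    using X(2) unfolding finite_nat_set_iff_bounded by blast
  have "y \<in> Pi\<^sub>E UNIV X" if "y \<in> cylinder x m" for y
  proof (rule PiE_I)
    fix i
    show "y i \<in> X i"
    proof (cases "X i = UNIV")
      case False
      with m have "i < m"
        by simp
      with that have "y i = x i"
        by (simp add: cylinder_def)
      then show ?thesis
        using PiE_mem[OF X(1) UNIV_I, of i] by simp
    qed simp
  qed simp
  then have "cylinder x m \<subseteq> U"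
    using X(3) by (meson subsetD subsetI)
  then show ?thesis
    by (rule that)
qed

lemma continuous_on_cylinderwise_constant:
  fixes g :: "(nat \<Rightarrow> 'a::discrete_topology) \<Rightarrow> 'b::topological_space"
  assumes "\<And>x y. y \<in> cylinder x m \<Longrightarrow> g y = g x"
  shows "continuous_on UNIV g"
proof -
  have "open (g -` U)" for U
  proof (subst open_subopen, intro ballI)
    fix x assume "x \<in> g -` U"
    then have "cylinder x m \<subseteq> g -` U"
      using assms by auto
    then show "\<exists>T. open T \<and> x \<in> T \<and> T \<subseteq> g -` U"
      by (intro exI[of _ "cylinder x m"]) auto
  qed
  then show ?thesis
    by (auto simp: continuous_on_open_vimage)
qed

text \<open>Discard all cylinders with countable image. By Lindelof, countably many of them cover
  the discarded set, so its image is countable and uncountably many values survive. Every cylinder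
  around a surviving point has uncountable image, so two survivors with distinct values can be
  separated.\<close>

lemma uncountable_image_cylinder_split:
  fixes f :: "(nat \<Rightarrow> nat) \<Rightarrow> 'a::t2_space"
  assumes f: "continuous_on UNIV f" and unc: "uncountable (f ` cylinder x m)"
  obtains y z k where "m < k" "y \<in> cylinder x m" "z \<in> cylinder x m"
    "uncountable (f ` cylinder y k)" "uncountable (f ` cylinder z k)"
    "f ` cylinder y k \<inter> f ` cylinder z k = {}"
proof -
  define \<F> where "\<F> = {cylinder y k |y k. countable (f ` cylinder y k)}"
  obtain \<F>' where \<F>': "\<F>' \<subseteq> \<F>" "countable \<F>'" "\<Union>\<F>' = \<Union>\<F>"
    by (rule Lindelof[of \<F>]) (auto simp: \<F>_def)
  have cyl_unc: "uncountable (f ` cylinder y k)" if "y \<notin> \<Union>\<F>" for y k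
    using that self_in_cylinder[of y k] by (force simp: \<F>_def)
  have "countable (f ` \<Union>\<F>)"
    unfolding \<F>'(3)[symmetric] image_Union
    using \<F>'(1,2) by (auto simp: \<F>_def intro!: countable_UN)
  then have "uncountable (f ` cylinder x m - f ` \<Union>\<F>)"
    using unc by (simp add: uncountable_minus_countable)
  then have unc': "uncountable (f ` (cylinder x m - \<Union>\<F>))"
    by (rule contrapos_nn) (erule countable_subset[rotated], blast)
  then have "cylinder x m - \<Union>\<F> \<noteq> {}"
    by (intro notI) simp
  then obtain y where y: "y \<in> cylinder x m - \<Union>\<F>"
    by blast
  have "\<not> f ` (cylinder x m - \<Union>\<F>) \<subseteq> {f y}"
    using unc' by (intro notI) (simp add: countable_subset[OF _ countable_finite])
  then obtain z where z: "z \<in> cylinder x m - \<Union>\<F>" "f y \<noteq> f z"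
    by fastforce
  obtain U V where UV: "open U" "open V" "f y \<in> U" "f z \<in> V" "U \<inter> V = {}"
    using hausdorff[OF z(2)] by blast
  obtain k where k: "cylinder y k \<subseteq> f -` U"
    using open_contains_cylinder[of "f -` U" y] open_vimage[OF UV(1) f] UV(3) by auto
  obtain l where l: "cylinder z l \<subseteq> f -` V"
    using open_contains_cylinder[of "f -` V" z] open_vimage[OF UV(2) f] UV(4) by auto
  \<comment> \<open>The maximum puts both images inside the separating open sets; \<open>Suc\<close>
    makes the new depth exceed \<open>m\<close>.\<close>
  define n where "n = Suc (max m (max k l))"
  have "cylinder y n \<subseteq> cylinder y k" "cylinder z n \<subseteq> cylinder z l"
    by (auto simp: cylinder_def n_def)
  then have "f ` cylinder y n \<subseteq> U" "f ` cylinder z n \<subseteq> V"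
    using k l by auto
  then have "f ` cylinder y n \<inter> f ` cylinder z n = {}"
    using UV(5) by blast
  moreover have "uncountable (f ` cylinder y n)" "uncountable (f ` cylinder z n)"
    using cyl_unc y z(1) by auto
  ultimately show ?thesis
    using that[of n y z] y z(1) by (simp add: n_def)
qed

text \<open>A Cantor scheme: iterated splitting gives a binary tree of cylinders, and
  \<open>h c\<close> is the point determined by the branch \<open>c\<close>. Siblings have disjoint
  images under \<open>f\<close>, which makes \<open>f\<close> after \<open>h\<close>
  injective.\<close>

theorem Cantor_space_embedding_into_image:
  fixes f :: "(nat \<Rightarrow> nat) \<Rightarrow> 'a::t2_space"
  assumes f: "continuous_on UNIV f" and unc: "uncountable (range f)"
  obtains h :: "(nat \<Rightarrow> bool) \<Rightarrow> nat \<Rightarrow> nat" where "continuous_on UNIV h" "inj (\<lambda>c. f (h c))"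
proof -
  define good where "good N \<longleftrightarrow> uncountable (f ` cylinder (fst N) (snd N))" for N
  have "\<exists>S. good N \<longrightarrow> (\<forall>b. good (S b) \<and> snd N < snd (S b) \<and> fst (S b) \<in> cylinder (fst N) (snd N)) \<and>
      f ` cylinder (fst (S True)) (snd (S True)) \<inter> f ` cylinder (fst (S False)) (snd (S False)) = {}" for N
  proof (cases "good N")
    case True
    then have "uncountable (f ` cylinder (fst N) (snd N))"
      by (simp add: good_def)
    then obtain y z k where "snd N < k" "y \<in> cylinder (fst N) (snd N)" "z \<in> cylinder (fst N) (snd N)"
      "uncountable (f ` cylinder y k)" "uncountable (f ` cylinder z k)"
      "f ` cylinder y k \<inter> f ` cylinder z k = {}"
      by (rule uncountable_image_cylinder_split[OF f])
    then show ?thesis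
      by (intro exI[of _ "\<lambda>b. if b then (y, k) else (z, k)"]) (auto simp: good_def)
  qed auto
  then obtain S where S: "\<And>N b. good N \<Longrightarrow> good (S N b)" "\<And>N b. good N \<Longrightarrow> snd N < snd (S N b)"
      "\<And>N b. good N \<Longrightarrow> fst (S N b) \<in> cylinder (fst N) (snd N)"
      "\<And>N. good N \<Longrightarrow> f ` cylinder (fst (S N True)) (snd (S N True)) \<inter>
          f ` cylinder (fst (S N False)) (snd (S N False)) = {}"
    by metis
  \<comment> \<open>A cylinder of depth 0 is the whole space, so the root may have any
    centre.\<close>
  define node where "node c = rec_nat (undefined, 0) (\<lambda>n N. S N (c n))" for c
  have node_0: "node c 0 = (undefined, 0)" and node_Suc: "node c (Suc n) = S (node c n) (c n)" for c n
    by (simp_all add: node_def)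
  define C where "C c n = cylinder (fst (node c n)) (snd (node c n))" for c n
  \<comment> \<open>Node \<open>Suc i\<close> has depth greater than \<open>i\<close>, so all later
    nodes of the branch share entry \<open>i\<close> of its centre.\<close>
  define h where "h c i = fst (node c (Suc i)) i" for c i
  have good: "good (node c n)" for c n
  proof (induction n)
    case 0
    then show ?case
      using unc by (simp add: node_0 good_def cylinder_def)
  qed (simp add: node_Suc S(1))
  have len: "n \<le> snd (node c n)" for c n
  proof (induction n)
    case (Suc n)
    then show ?case
      using S(2)[OF good[of c n], of "c n"] by (simp add: node_Suc)
  qed simp
  have C_antimono: "C c n \<subseteq> C c k" if "k \<le> n" for c k n
    using that
  proof (induction rule: dec_induct)
    case (step j)
    have "C c (Suc j) \<subseteq> C c j"
      unfolding C_def node_Suc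
      by (intro cylinder_subset S(3) good less_imp_le S(2))
    with step show ?case by blast
  qed simp
  have h_in: "h c \<in> C c n" for c n
    unfolding C_def cylinder_def
  proof (intro CollectI allI impI)
    fix i assume i: "i < snd (node c n)"
    \<comment> \<open>Node \<open>j\<close> lies below both node \<open>n\<close> and node
      \<open>Suc i\<close>, so its centre agrees with both of theirs at \<open>i\<close>.\<close>
    define j where "j = max n (Suc i)"
    have "fst (node c j) \<in> C c j"
      by (simp add: C_def)
    then have "fst (node c j) \<in> C c n" "fst (node c j) \<in> C c (Suc i)"
      using C_antimono[of n j c] C_antimono[of "Suc i" j c] by (auto simp: j_def)
    moreover have "i < snd (node c (Suc i))"
      using len[of "Suc i" c] by simp
    ultimately show "h c i = fst (node c n) i"
      using i unfolding h_def C_def cylinder_def by auto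
  qed
  have node_cong: "node d n = node c n" if "d \<in> cylinder c n" for c d n
    using that by (induction n) (auto simp: node_0 node_Suc cylinder_def)
  have "continuous_on UNIV h"
  proof (rule continuous_on_coordinatewise_then_product)
    fix i
    show "continuous_on UNIV (\<lambda>c. h c i)"
      by (rule continuous_on_cylinderwise_constant[of "Suc i"]) (simp add: h_def node_cong)
  qed
  moreover have "f (h c) \<noteq> f (h d)" if "c \<noteq> d" for c d
  proof -
    \<comment> \<open>Up to the first disagreement \<open>n\<close> both branches visit the same
      nodes; then they enter siblings.\<close>
    define n where "n = (LEAST n. c n \<noteq> d n)"
    have "\<exists>n. c n \<noteq> d n"
      using that by (simp add: fun_eq_iff)
    then have "c n \<noteq> d n"
      unfolding n_def by (rule LeastI_ex)
    have "d \<in> cylinder c n"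
      unfolding n_def cylinder_def by (auto dest: not_less_Least)
    then have eq: "node d n = node c n"
      by (rule node_cong)
    have "f ` C c (Suc n) \<inter> f ` C d (Suc n) = {}"
      using S(4)[OF good, of c n] \<open>c n \<noteq> d n\<close>
      by (cases "c n"; cases "d n") (simp_all add: C_def node_Suc eq Int_commute)
    then show ?thesis
      using h_in[of c "Suc n"] h_in[of d "Suc n"] by blast
  qed
  then have "inj (\<lambda>c. f (h c))"
    by (meson injI)
  ultimately show ?thesis
    using that by blast
qed

lemma compact_Cantor_space: "compact (UNIV :: (nat \<Rightarrow> bool) set)"
proof -
  have "compact (UNIV :: bool set)"
    by (simp add: finite_imp_compact)
  then show ?thesis
    using compact_space_product_topology[of "\<lambda>_::nat. euclidean::bool topology" UNIV]
    by (simp add: euclidean_product_topology compact_space_def)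
qed

section \<open>Decoding sequences of natural numbers from points of the Cantor space\<close>

text \<open>
  If row \<open>(i, n)\<close> of \<open>c\<close> contains no \<open>True\<close>, the value is an unspecified constant;
  this affects neither measurability nor surjectivity.
\<close>

definition decode :: "nat \<Rightarrow> (nat \<Rightarrow> bool) \<Rightarrow> nat \<Rightarrow> nat" where
  "decode i c n = (LEAST k. c (prod_encode (i, prod_encode (n, k))))"

text \<open>Each coordinate is the least \<open>k\<close> satisfying an open condition on
  \<open>c\<close>. It is Borel, but not continuous where a row is empty.\<close>

lemma borel_measurable_decode [measurable]: "decode i \<in> borel_measurable borel"
proof (rule measurable_coordinatewise_then_product)
  fix n
  have [measurable]: "Measurable.pred borel (\<lambda>c :: nat \<Rightarrow> bool. c j)" for j
  proof -
    have "open ((\<lambda>c :: nat \<Rightarrow> bool. c j) -` {True})"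
      by (intro open_vimage open_discrete continuous_on_product_coordinates)
    then show ?thesis
      by (simp add: pred_def vimage_def)
  qed
  have "(\<lambda>c. decode i c n) \<in> measurable borel (count_space UNIV)"
    unfolding decode_def by measurable
  then show "(\<lambda>c. decode i c n) \<in> borel_measurable borel"
    by (rule measurable_compose[where g = "\<lambda>x. x"]) simp
qed

text \<open>Infinitely many codes allow a choice that avoids two prescribed vertices.\<close>

lemma infinite_decode_pair: "infinite {c. decode 0 c = u \<and> decode 1 c = v}"
proof -
  \<comment> \<open>The entries with \<open>i = 0\<close> and \<open>i = 1\<close> hold the graphs
    of \<open>u\<close> and \<open>v\<close>. Those with larger \<open>i\<close> do not affect
    \<open>decode 0\<close> and \<open>decode 1\<close>, so they can record
    \<open>r\<close>.\<close>
  define code where "code r j = (case prod_decode j of (i, l) \<Rightarrow> case prod_decode l of (n, k) \<Rightarrow>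
      if i = 0 then k = u n else if i = 1 then k = v n else n = (r::nat))" for r j
  have "decode 0 (code r) = u" "decode 1 (code r) = v" for r
    by (auto simp: decode_def code_def fun_eq_iff intro!: Least_equality)
  then have "range code \<subseteq> {c. decode 0 c = u \<and> decode 1 c = v}"
    by auto
  moreover have "inj code"
  proof (rule injI)
    fix r s assume "code r = code s"
    \<comment> \<open>This entry is true in \<open>code r\<close>, and true in \<open>code s\<close>
      only if \<open>r = s\<close>.\<close>
    then have "code r (prod_encode (2, prod_encode (r, 0))) = code s (prod_encode (2, prod_encode (r, 0)))"
      by simp
    then show "r = s"
      by (simp add: code_def)
  qed
  ultimately show ?thesis
    using infinite_iff_countable_subset by blast
qed

section \<open>The two graphs\<close>

lemma pred_borel_eq:
  fixes u v :: "'b \<Rightarrow> 'a::{second_countable_topology, metric_space}"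
  assumes [measurable]: "u \<in> borel_measurable M" "v \<in> borel_measurable M"
  shows "Measurable.pred M (\<lambda>w. u w = v w)"
proof -
  have "Measurable.pred M (\<lambda>w. dist (u w) (v w) = 0)"
    by measurable
  then show ?thesis by simp
qed

text \<open>Take three points \<open>T\<close> of \<open>A\<close> and a point \<open>y\<close>
  outside \<open>T\<close> and outside the finite set of vertices chosen by \<open>T\<close>. In a
  complete graph all three edges between \<open>T\<close> and \<open>y\<close> would have to be
  chosen by \<open>y\<close>, which chooses at most two.\<close>

lemma not_complete_if_outdegree_le_2:
  assumes "infinite A"
    and G: "\<And>x y. (x, y) \<in> G \<Longrightarrow> y \<in> {F x, F' x} \<or> x \<in> {F y, F' y}"
  obtains x y where "x \<in> A" "y \<in> A" "x \<noteq> y" "(x, y) \<notin> G"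
proof (rule ccontr)
  assume "\<not> thesis"
  then have complete: "\<forall>x\<in>A. \<forall>y\<in>A. x \<noteq> y \<longrightarrow> (x, y) \<in> G"
    using that by blast
  obtain T where T: "T \<subseteq> A" "finite T" "card T = 3"
    using infinite_arbitrarily_large[OF \<open>infinite A\<close>] by blast
  have "infinite (A - (T \<union> F ` T \<union> F' ` T))"
    using \<open>infinite A\<close> T(2) by (intro Diff_infinite_finite) auto
  then obtain y where y: "y \<in> A" "y \<notin> T" "y \<notin> F ` T" "y \<notin> F' ` T"
    by (metis DiffE UnI1 UnI2 ex_in_conv finite.emptyI)
  have "T \<subseteq> {F y, F' y}"
  proof
    fix x assume "x \<in> T"
    then have "(x, y) \<in> G"
      using complete T(1) y(1,2) by auto
    then show "x \<in> {F y, F' y}"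
      using G[of x y] \<open>x \<in> T\<close> y(3,4) by auto
  qed
  then have "card T \<le> card {F y, F' y}"
    by (intro card_mono) auto
  also have "\<dots> \<le> 2"
    by (simp add: card_insert_if)
  finally show False
    using T(3) by simp
qed

lemma countable_star_graph:
  fixes A :: "'a::metric_space set"
  assumes "countable A" "A \<noteq> {}"
  shows "\<exists>G. graph_rel G \<and> G \<in> sets borel \<and> G \<subseteq> A \<times> A \<and> graph_component G A \<and>
           graph_diameter G \<le> 2 \<and> (infinite A \<or> card A \<ge> 3 \<longrightarrow> graph_diameter G = 2)"
proof -
  obtain a where a: "a \<in> A"
    using assms(2) by blast
  define G where "G = {a} \<times> (A - {a}) \<union> (A - {a}) \<times> {a}"
  have "sym G"
    by (auto simp: G_def sym_def)
  have "irrefl G"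
    by (auto simp: G_def irrefl_def)
  have "G \<subseteq> A \<times> A"
    using a by (auto simp: G_def)
  have "countable G"
    using assms(1) by (auto simp: G_def)
  then have "G \<in> sets borel"
    by (rule sets.countable[OF borel_closed[OF closed_singleton]])
  have "(x, y) \<in> G \<or> (\<exists>z. (x, z) \<in> G \<and> (z, y) \<in> G)" if "x \<in> A" "y \<in> A" "x \<noteq> y" for x y
    using that by (auto simp: G_def)
  note comp = graph_component_diameter_le_2I[OF \<open>sym G\<close> \<open>G \<subseteq> A \<times> A\<close> a this]
  have "2 \<le> graph_diameter G" if "infinite A \<or> card A \<ge> 3"
  proof -
    \<comment> \<open>With at least three points in \<open>A\<close> there are two distinct leaves;
      they are joined only through the centre.\<close>
    have "\<not> A - {a} \<subseteq> {x}" for x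
    proof
      assume "A - {a} \<subseteq> {x}"
      then have "A \<subseteq> {a, x}"
        by auto
      then have "finite A" "card A \<le> card {a, x}"
        by (auto intro: finite_subset card_mono)
      moreover have "card {a, x} \<le> 2"
        by (simp add: card_insert_if)
      ultimately show False
        using that by simp
    qed
    then obtain x y where "x \<in> A - {a}" "y \<in> A - {a}" "x \<noteq> y"
      by (metis singletonI subsetI)
    then show ?thesis
      by (intro graph_diameter_ge_2I[of x y]) (auto simp: G_def intro: rtrancl_trans[of _ a])
  qed
  then show ?thesis
    using comp \<open>sym G\<close> \<open>irrefl G\<close> \<open>G \<subseteq> A \<times> A\<close> \<open>G \<in> sets borel\<close>
    by (intro exI[of _ G]) (auto simp: graph_rel_def intro: antisym)
qed

lemma uncountable_analytic_graph:
  fixes f :: "(nat \<Rightarrow> nat) \<Rightarrow> 'a::polish_space"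
  assumes f: "continuous_on UNIV f" and unc: "uncountable (range f)"
  shows "\<exists>G. graph_rel G \<and> G \<in> sets borel \<and> G \<subseteq> range f \<times> range f \<and> graph_component G (range f) \<and>
           graph_diameter G = 2"
proof -
  obtain h :: "(nat \<Rightarrow> bool) \<Rightarrow> nat \<Rightarrow> nat"
    where h: "continuous_on UNIV h" and inj: "inj (\<lambda>c. f (h c))"
    using Cantor_space_embedding_into_image[OF f unc] by blast
  define \<phi> where "\<phi> = (\<lambda>c. f (h c))"
  define P where "P = range \<phi>"
  define \<psi> where "\<psi> = inv \<phi>"
  have cont: "continuous_on UNIV \<phi>"
    unfolding \<phi>_def by (rule continuous_on_compose2[OF f h]) simp
  have "inj \<phi>"
    using inj by (simp add: \<phi>_def)
  then have \<psi>\<phi>: "\<psi> (\<phi> c) = c" for c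
    by (simp add: \<psi>_def)
  have "compact P"
    unfolding P_def by (rule compact_continuous_image[OF cont compact_Cantor_space])
  then have P_borel [measurable]: "P \<in> sets borel"
    by (simp add: borel_compact)
  \<comment> \<open>A continuous injection on a compact space has a continuous inverse on its
    image.\<close>
  have "continuous_on P \<psi>"
    unfolding P_def by (rule continuous_on_inv[OF cont compact_Cantor_space]) (simp add: \<psi>\<phi>)
  \<comment> \<open>Extension by a constant off the Borel set \<open>P\<close> gives a total Borel
    function.\<close>
  define \<psi>' where "\<psi>' p = (if p \<in> P then \<psi> p else undefined)" for p
  have [measurable]: "\<psi>' \<in> borel_measurable borel"
    unfolding \<psi>'_def
    by (intro borel_measurable_continuous_on_if \<open>continuous_on P \<psi>\<close>) auto
  have [measurable]: "f \<in> borel_measurable borel"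
    using f by (rule borel_measurable_continuous_onI)
  define F where "F i p = f (decode i (\<psi>' p))" for i p
  have [measurable]: "F i \<in> borel_measurable borel" for i
    unfolding F_def by measurable
  \<comment> \<open>\<open>R p z\<close> says that \<open>p\<close> chooses \<open>z\<close>; the
    last conjunct excludes loops.\<close>
  define R where "R p z \<longleftrightarrow> p \<in> P \<and> (z = F 0 p \<or> z = F 1 p) \<and> z \<noteq> p" for p z
  have R_pred: "Measurable.pred M (\<lambda>w. R (u w) (v w))"
    if [measurable]: "u \<in> borel_measurable M" "v \<in> borel_measurable M"
    for M :: "('a \<times> 'a) measure" and u v
  proof -
    note pred_borel_eq[measurable]
    show ?thesis
      unfolding R_def by measurable
  qed
  define G where "G = {(p, z). R p z \<or> R z p}"
  have "sym G"
    by (auto simp: G_def sym_def)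
  have "irrefl G"
    by (auto simp: G_def irrefl_def R_def)
  have "G \<subseteq> range f \<times> range f"
    by (auto simp: G_def R_def F_def P_def \<phi>_def)
  have "G \<in> sets borel"
  proof -
    \<comment> \<open>The Borel structure here is that of the product topology, so the projections
      are measurable by continuity.\<close>
    have fst_snd: "fst \<in> borel_measurable (borel :: ('a \<times> 'a) measure)"
      "snd \<in> borel_measurable (borel :: ('a \<times> 'a) measure)"
      by (auto intro!: borel_measurable_continuous_onI continuous_intros)
    note [measurable] = R_pred[OF fst_snd] R_pred[OF fst_snd(2,1)]
    have "Measurable.pred borel (\<lambda>w :: 'a \<times> 'a. R (fst w) (snd w) \<or> R (snd w) (fst w))"
      by measurable
    then show ?thesis
      by (simp add: pred_def G_def case_prod_beta)
  qed
  have two: "\<exists>z. (x, z) \<in> G \<and> (z, y) \<in> G" if xy: "x \<in> range f" "y \<in> range f" for x y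
  proof -
    obtain u v where uv: "x = f u" "y = f v"
      using xy by blast
    have "infinite (\<phi> ` {c. decode 0 c = u \<and> decode 1 c = v})"
      using infinite_decode_pair \<open>inj \<phi>\<close> by (meson finite_imageD inj_on_subset subset_UNIV)
    \<comment> \<open>The code must differ from \<open>x\<close> and \<open>y\<close>, as otherwise
      one of its two edges would be an excluded loop.\<close>
    then have "infinite (\<phi> ` {c. decode 0 c = u \<and> decode 1 c = v} - {x, y})"
      by simp
    then obtain p where "p \<in> \<phi> ` {c. decode 0 c = u \<and> decode 1 c = v} - {x, y}"
      by (metis equals0I finite.emptyI)
    then obtain c where c: "p = \<phi> c" "decode 0 c = u" "decode 1 c = v" "p \<noteq> x" "p \<noteq> y"
      by auto
    have "p \<in> P"
      by (simp add: P_def c)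
    moreover have "F 0 p = x" "F 1 p = y"
      using \<open>p \<in> P\<close> c uv by (simp_all add: F_def \<psi>'_def \<psi>\<phi>)
    ultimately have "R p x" "R p y"
      using c by (auto simp: R_def)
    then show ?thesis
      by (auto simp: G_def)
  qed
  obtain a where "a \<in> range f"
    by blast
  note comp = graph_component_diameter_le_2I[OF \<open>sym G\<close> \<open>G \<subseteq> range f \<times> range f\<close> this disjI2, OF two]
  have "infinite (range f)"
    using unc countable_finite by blast
  then obtain x y where xy: "x \<in> range f" "y \<in> range f" "x \<noteq> y" "(x, y) \<notin> G"
    by (rule not_complete_if_outdegree_le_2[where G = G and F = "F 0" and F' = "F 1"])
      (auto simp: G_def R_def)
  have "(x, y) \<in> G\<^sup>*"
    using two[OF xy(1,2)] by (meson r_into_rtrancl rtrancl_trans)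
  then have "2 \<le> graph_diameter G"
    using xy by (intro graph_diameter_ge_2I)
  then show ?thesis
    using comp \<open>sym G\<close> \<open>irrefl G\<close> \<open>G \<subseteq> range f \<times> range f\<close> \<open>G \<in> sets borel\<close>
    by (intro exI[of _ G]) (auto simp: graph_rel_def intro: antisym)
qed

text \<open>Components are nonempty, hence \<open>A \<noteq> {}\<close>. Diameter exactly 2 needs
  three points: a connected graph on one or two points has diameter 0 or 1. Infinite sets are listed
  separately because their \<open>card\<close> is 0.\<close>

theorem theorem1p7:
  fixes A :: "'a::polish_space set"
  assumes "analytic_set A" and "A \<noteq> {}"
  shows "\<exists>G :: ('a \<times> 'a) set.
           graph_rel G \<and> G \<in> sets borel \<and> G \<subseteq> A \<times> A \<and>
           graph_component G A \<and>
           graph_diameter G \<le> 2 \<and>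
           (infinite A \<or> card A \<ge> 3 \<longrightarrow> graph_diameter G = 2)"
proof (cases "countable A")
  case True
  then show ?thesis
    using assms(2) by (rule countable_star_graph)
next
  case False
  obtain f :: "(nat \<Rightarrow> nat) \<Rightarrow> 'a" where "continuous_on UNIV f" "range f = A"
    using assms by (auto simp: analytic_set_def)
  then show ?thesis
    using uncountable_analytic_graph[of f] False by (metis order_refl)
qed

end
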